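(* Let $(X,d)$ be a compact metric space without isolated points and let $T\colon X\to X$ be a transitive continuous map with the shadowing property. If $T$ is not uniquely ergodic, then $\mathcal{CI}(X,T)\subseteq\mathrm{Trans}(X,T)$.
   Context: $\mathbb{N}=\{1,2,\dots\}$. $T$ is transitive if for all nonempty open $U,V\subset X$ there is $n\in\mathbb{N}$ with $U\cap T^{-n}(V)\ne\emptyset$. $T$ is uniquely ergodic if it has exactly one invariant Borel probability measure. A sequence $\{x_n\}_{n\in\mathbb{N}}\subset X$ is a $\delta$-pseudo-orbit if $d(T(x_n),x_{n+1})<\delta$ for all $n\in\mathbb{N}$; it is $\varepsilon$-shadowed if there is $y\in X$ with $d(T^n(y),x_n)<\varepsilon$ for all $n\in\mathbb{N}$. $T$ has the shadowing property if for every $\varepsilon>0$ there is $\delta>0$ such that every $\delta$-pseudo-orbit is $\varepsilon$-shadowed. $\mathrm{Trans}(X,T)$ is the set of points $x\in X$ whose orbit $\{T^n(x)\colon n\ge0\}$ is dense in $X$. For $\varphi\in C^0(X,\mathbb{R})$ (continuous real-valued functions), $\mathcal{I}(T,\varphi)$ is the set of $x\in X$ such that $\big(\frac1n\sum_{j=0}^{n-1}\varphi(T^j(x))\big)_{n\ge1}$ does not converge; $\mathcal{H}(X,T)=\{\varphi\in C^0(X,\mathbb{R})\colon\mathcal{I}(T,\varphi)\neq\emptyset\}$; $\mathcal{CI}(X,T)=\bigcap_{\varphi\in\mathcal{H}(X,T)}\mathcal{I}(T,\varphi)$ is the set of completely irregular points. *)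

theory Defs
  imports "HOL-Probability.Probability"
begin

text \<open>
  The space \<open>X\<close> is the whole type \<open>'a\<close>.  The index set \<open>\<nat> = {1, 2, \<dots>}\<close> of the source starts
  at 1 and is rendered by the guard \<open>n \<ge> 1\<close>; the value \<open>x 0\<close> of a sequence is thus irrelevant.
\<close>

definition topologically_transitive :: "('a::topological_space \<Rightarrow> 'a) \<Rightarrow> bool" where
  "topologically_transitive T \<longleftrightarrow>
     (\<forall>U V. open U \<and> U \<noteq> {} \<and> open V \<and> V \<noteq> {} \<longrightarrow> (\<exists>n\<ge>1. U \<inter> (T ^^ n) -` V \<noteq> {}))"

definition pseudo_orbit :: "('a::metric_space \<Rightarrow> 'a) \<Rightarrow> real \<Rightarrow> (nat \<Rightarrow> 'a) \<Rightarrow> bool" where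
  "pseudo_orbit T \<delta> x \<longleftrightarrow> (\<forall>n\<ge>1. dist (T (x n)) (x (Suc n)) < \<delta>)"

definition shadowed :: "('a::metric_space \<Rightarrow> 'a) \<Rightarrow> real \<Rightarrow> (nat \<Rightarrow> 'a) \<Rightarrow> bool" where
  "shadowed T \<epsilon> x \<longleftrightarrow> (\<exists>y. \<forall>n\<ge>1. dist ((T ^^ n) y) (x n) < \<epsilon>)"

definition shadowing_property :: "('a::metric_space \<Rightarrow> 'a) \<Rightarrow> bool" where
  "shadowing_property T \<longleftrightarrow>
     (\<forall>\<epsilon>>0. \<exists>\<delta>>0. \<forall>x. pseudo_orbit T \<delta> x \<longrightarrow> shadowed T \<epsilon> x)"

definition invariant_prob :: "('a::topological_space \<Rightarrow> 'a) \<Rightarrow> 'a measure \<Rightarrow> bool" where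
  "invariant_prob T \<mu> \<longleftrightarrow>
     prob_space \<mu> \<and> sets \<mu> = sets borel \<and> (\<forall>A\<in>sets borel. emeasure \<mu> (T -` A) = emeasure \<mu> A)"

definition uniquely_ergodic :: "('a::topological_space \<Rightarrow> 'a) \<Rightarrow> bool" where
  "uniquely_ergodic T \<longleftrightarrow> (\<exists>!\<mu>. invariant_prob T \<mu>)"

definition Trans :: "('a::topological_space \<Rightarrow> 'a) \<Rightarrow> 'a set" where
  "Trans T = {x. closure (range (\<lambda>n. (T ^^ n) x)) = UNIV}"

text \<open>The term \<open>n = 0\<close> of the sequence of averages is \<open>0 / 0 = 0\<close> and does not affect convergence.\<close>

definition irregular_set :: "('a \<Rightarrow> 'a) \<Rightarrow> ('a \<Rightarrow> real) \<Rightarrow> 'a set" where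
  "irregular_set T \<phi> = {x. \<not> convergent (\<lambda>n. (\<Sum>j<n. \<phi> ((T ^^ j) x)) / real n)}"

definition irregular_observables :: "('a::topological_space \<Rightarrow> 'a) \<Rightarrow> ('a \<Rightarrow> real) set" where
  "irregular_observables T = {\<phi>. continuous_on UNIV \<phi> \<and> irregular_set T \<phi> \<noteq> {}}"

definition completely_irregular :: "('a::topological_space \<Rightarrow> 'a) \<Rightarrow> 'a set" where
  "completely_irregular T = (\<Inter>\<phi>\<in>irregular_observables T. irregular_set T \<phi>)"

end

theory Submission
  imports Defs
begin

text \<open>
  The contrapositive is proved: if the orbit of \<open>x\<close> is not dense, some observable \<open>\<phi>\<close> has
  convergent averages along \<open>x\<close> and divergent averages along another point, so that \<open>x\<close> is not
  completely irregular.

  Let \<open>K\<close> be the orbit closure of \<open>x\<close> and \<open>q\<close> a point outside \<open>K\<close>.  Take a continuous \<open>\<phi>\<close> with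
  values in \<open>[0, 1]\<close> that vanishes near \<open>K\<close> and equals \<open>1\<close> near \<open>q\<close>.  Its averages along \<open>x\<close> are all
  zero, so only a point with divergent averages is missing.

  Transitivity provides an orbit segment that starts and ends close to \<open>q\<close>; repeating it gives a
  pseudo-orbit, and a point \<open>w\<close> that shadows it visits the neighbourhood of \<open>q\<close> with frequency at
  least \<open>1 / L\<close>, where \<open>L\<close> is the length of the segment (\<open>regularly_returning_point\<close>).  In the
  same way, every nonempty open set contains points whose orbits end up following the orbit of
  \<open>x\<close>, and points whose orbits end up following the orbit of \<open>w\<close> (\<open>dense_tail_tracing\<close>).  The
  averages of \<open>\<phi>\<close> tend to \<open>0\<close> for the former and have upper limit at least \<open>1 / L\<close> for the latter.
  Both behaviours thus occur densely, and by Baire's theorem a generic point has averages that fall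
  below \<open>1 / (4 * L)\<close> and exceed \<open>1 / (2 * L)\<close> infinitely often
  (\<open>dense_oscillation_imp_not_convergent\<close>).
\<close>

section \<open>Generic divergence\<close>

text \<open>
  The two conditions make \<open>{z. \<exists>n\<ge>N. A n z < a}\<close> and \<open>{z. \<exists>n\<ge>N. A n z > b}\<close> dense for each \<open>N\<close>;
  they are open since the functions are continuous.  By Baire's theorem some \<open>z\<close> lies in all of
  these sets, and a limit of \<open>A n z\<close> would be both at most \<open>a\<close> and at least \<open>b\<close>.
\<close>

lemma dense_oscillation_imp_not_convergent:
  fixes A :: "nat \<Rightarrow> 'a::metric_space \<Rightarrow> real"
  assumes compact: "compact (UNIV :: 'a set)"
    and cont: "\<And>n. continuous_on UNIV (A n)"
    and "a < b"
    and low: "\<And>U N. open U \<Longrightarrow> U \<noteq> {} \<Longrightarrow> \<exists>z\<in>U. \<exists>n\<ge>N. A n z < a"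
    and high: "\<And>U N. open U \<Longrightarrow> U \<noteq> {} \<Longrightarrow> \<exists>z\<in>U. \<exists>n\<ge>N. A n z > b"
  shows "\<exists>z. \<not> convergent (\<lambda>n. A n z)"
proof -
  define D where "D N = {z. \<exists>n\<ge>N. A n z < a}" for N
  define E where "E N = {z. \<exists>n\<ge>N. A n z > b}" for N
  have D_open: "open (D N)" for N
  proof -
    have "D N = (\<Union>n\<in>{N..}. {z. A n z < a})" by (auto simp: D_def)
    then show ?thesis using cont by (auto intro!: open_Collect_less continuous_on_const)
  qed
  have E_open: "open (E N)" for N
  proof -
    have "E N = (\<Union>n\<in>{N..}. {z. A n z > b})" by (auto simp: E_def)
    then show ?thesis using cont by (auto intro!: open_Collect_less continuous_on_const)
  qed
  have D_dense: "closure (D N) = UNIV" for N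
  proof -
    have "UNIV - closure (D N) = {}"
      using low [of "UNIV - closure (D N)" N] closure_subset [of "D N"]
      by (fastforce simp: D_def)
    then show ?thesis by auto
  qed
  have E_dense: "closure (E N) = UNIV" for N
  proof -
    have "UNIV - closure (E N) = {}"
      using high [of "UNIV - closure (E N)" N] closure_subset [of "E N"]
      by (fastforce simp: E_def)
    then show ?thesis by auto
  qed
  have "compact_space (euclidean :: 'a topology)"
    using compact by (simp add: compact_space_def)
  then have "euclidean closure_of \<Inter>(range D \<union> range E) = topspace (euclidean :: 'a topology)"
    using D_open E_open D_dense E_dense
    by (intro Baire_category disjI2 conjI compact_imp_locally_compact_space regular_space_euclidean)
      auto
  then obtain z where z: "\<And>N. z \<in> D N" "\<And>N. z \<in> E N"
    by (cases "\<Inter>(range D \<union> range E) = {}") fastforce+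
  have "\<not> convergent (\<lambda>n. A n z)"
  proof
    assume "convergent (\<lambda>n. A n z)"
    then obtain l where l: "(\<lambda>n. A n z) \<longlonglongrightarrow> l" by (auto simp: convergent_def)
    have "l \<le> a"
    proof (rule ccontr)
      assume "\<not> l \<le> a"
      then obtain N where "\<And>n. n \<ge> N \<Longrightarrow> A n z > a"
        using order_tendstoD(1) [OF l, of a] by (auto simp: eventually_sequentially)
      with z(1) [of N] show False by (force simp: D_def)
    qed
    moreover have "b \<le> l"
    proof (rule ccontr)
      assume "\<not> b \<le> l"
      then obtain N where "\<And>n. n \<ge> N \<Longrightarrow> A n z < b"
        using order_tendstoD(2) [OF l, of b] by (auto simp: eventually_sequentially)
      with z(2) [of N] show False by (force simp: E_def)
    qed
    ultimately show False using \<open>a < b\<close> by simp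
  qed
  then show ?thesis ..
qed

section \<open>Orbits traced by shadowing\<close>

text \<open>
  Transitivity provides an orbit segment from \<open>U\<close> to a point close to \<open>w\<close>.  The segment followed by
  the orbit of \<open>w\<close> is a pseudo-orbit, and \<open>z\<close> shadows it.
\<close>

lemma dense_tail_tracing:
  fixes T :: "'a::metric_space \<Rightarrow> 'a"
  assumes trans: "topologically_transitive T"
    and shadow: "shadowing_property T"
    and "open U" "U \<noteq> {}" "0 < \<epsilon>"
  shows "\<exists>z\<in>U. \<exists>m. \<forall>j. dist ((T ^^ (m + j)) z) ((T ^^ j) w) < \<epsilon>"
proof -
  obtain u r where "0 < r" and u: "ball u r \<subseteq> U"
    using \<open>open U\<close> \<open>U \<noteq> {}\<close> by (metis ex_in_conv open_contains_ball)
  \<comment> \<open>Half of the radius is for the start of the segment, half for the shadowing error.\<close>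
  define \<eta> where "\<eta> = min \<epsilon> (r / 2)"
  have "0 < \<eta>" using \<open>0 < r\<close> \<open>0 < \<epsilon>\<close> by (simp add: \<eta>_def)
  then obtain \<delta> where "0 < \<delta>" and \<delta>: "\<And>s. pseudo_orbit T \<delta> s \<Longrightarrow> shadowed T \<eta> s"
    using shadow unfolding shadowing_property_def by blast
  have "ball u \<eta> \<noteq> {}" "ball w \<delta> \<noteq> {}" using \<open>0 < \<eta>\<close> \<open>0 < \<delta>\<close> by auto
  then obtain n p where "n \<ge> 1" and p: "p \<in> ball u \<eta>" "(T ^^ n) p \<in> ball w \<delta>"
    using trans unfolding topologically_transitive_def by (blast elim: vimageE)
  \<comment> \<open>Pseudo-orbits are indexed from \<open>1\<close>, so \<open>t i\<close> appears at index \<open>Suc i\<close>.\<close>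
  define t where "t i = (if i < n then (T ^^ i) p else (T ^^ (i - n)) w)" for i
  have step: "dist (T (t i)) (t (Suc i)) < \<delta>" for i
  proof (cases "Suc i = n")
    case True
    then have "T (t i) = (T ^^ n) p" "t (Suc i) = w" by (auto simp: t_def)
    then show ?thesis using p(2) by (simp add: dist_commute)
  next
    case False
    then have "T (t i) = t (Suc i)" by (auto simp: t_def Suc_diff_le)
    then show ?thesis using \<open>0 < \<delta>\<close> by simp
  qed
  have "pseudo_orbit T \<delta> (\<lambda>i. t (i - 1))"
    unfolding pseudo_orbit_def
  proof (intro allI impI)
    fix i :: nat assume "i \<ge> 1"
    then show "dist (T (t (i - 1))) (t (Suc i - 1)) < \<delta>" using step [of "i - 1"] by simp
  qed
  then obtain y where y: "\<And>i. i \<ge> 1 \<Longrightarrow> dist ((T ^^ i) y) (t (i - 1)) < \<eta>"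
    using \<delta> unfolding shadowed_def by blast
  have z: "dist ((T ^^ i) (T y)) (t i) < \<eta>" for i
    using y [of "Suc i"] by (simp add: funpow_swap1)
  have "dist (T y) p < \<eta>" using z [of 0] \<open>n \<ge> 1\<close> by (simp add: t_def)
  moreover have "dist u p < \<eta>" using p(1) by simp
  ultimately have "dist u (T y) < 2 * \<eta>"
    using dist_triangle2 [of u "T y" p] by simp
  then have "T y \<in> U" using u by (auto simp: \<eta>_def)
  moreover have "dist ((T ^^ (n + j)) (T y)) ((T ^^ j) w) < \<epsilon>" for j
    using z [of "n + j"] by (simp add: t_def \<eta>_def)
  ultimately show ?thesis by blast
qed

text \<open>
  An orbit segment that starts and ends close to \<open>q\<close> can be repeated forever: the result is a
  pseudo-orbit of period \<open>L\<close>, and a point that shadows it is close to \<open>q\<close> at all multiples of \<open>L\<close>.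
\<close>

lemma regularly_returning_point:
  fixes T :: "'a::metric_space \<Rightarrow> 'a"
  assumes trans: "topologically_transitive T"
    and shadow: "shadowing_property T"
    and "0 < \<epsilon>"
  shows "\<exists>w. \<exists>L\<ge>1. \<forall>k. dist ((T ^^ (k * L)) w) q < \<epsilon>"
proof -
  obtain \<delta> where "0 < \<delta>" and \<delta>: "\<And>s. pseudo_orbit T \<delta> s \<Longrightarrow> shadowed T (\<epsilon> / 2) s"
    using shadow \<open>0 < \<epsilon>\<close> unfolding shadowing_property_def by (meson half_gt_zero)
  define \<eta> where "\<eta> = min (\<epsilon> / 2) (\<delta> / 2)"
  have "0 < \<eta>" using \<open>0 < \<epsilon>\<close> \<open>0 < \<delta>\<close> by (simp add: \<eta>_def)
  then have "ball q \<eta> \<noteq> {}" by auto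
  then obtain L p where "L \<ge> 1" and p: "p \<in> ball q \<eta>" "(T ^^ L) p \<in> ball q \<eta>"
    using trans unfolding topologically_transitive_def by (blast elim: vimageE)
  have jump: "dist ((T ^^ L) p) p < \<delta>"
    using p dist_triangle3 [of "(T ^^ L) p" p q] by (simp add: \<eta>_def)
  define t where "t i = (T ^^ (i mod L)) p" for i
  have step: "dist (T (t i)) (t (Suc i)) < \<delta>" for i
  proof (cases "Suc (i mod L) = L")
    case True
    have "T (t i) = (T ^^ Suc (i mod L)) p" by (simp add: t_def)
    moreover have "t (Suc i) = p" using True by (simp add: t_def mod_Suc)
    ultimately show ?thesis using jump True by simp
  next
    case False
    then have "T (t i) = t (Suc i)" by (auto simp: t_def mod_Suc)
    then show ?thesis using \<open>0 < \<delta>\<close> by simp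
  qed
  have "pseudo_orbit T \<delta> (\<lambda>i. t (i - 1))"
    unfolding pseudo_orbit_def
  proof (intro allI impI)
    fix i :: nat assume "i \<ge> 1"
    then show "dist (T (t (i - 1))) (t (Suc i - 1)) < \<delta>" using step [of "i - 1"] by simp
  qed
  then obtain y where y: "\<And>i. i \<ge> 1 \<Longrightarrow> dist ((T ^^ i) y) (t (i - 1)) < \<epsilon> / 2"
    using \<delta> unfolding shadowed_def by blast
  have "dist ((T ^^ (k * L)) (T y)) q < \<epsilon>" for k
  proof -
    have "dist ((T ^^ (k * L)) (T y)) p < \<epsilon> / 2"
      using y [of "Suc (k * L)"] by (simp add: t_def funpow_swap1)
    moreover have "dist q p < \<epsilon> / 2" using p(1) by (simp add: \<eta>_def)
    ultimately show ?thesis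
      using dist_triangle2 [of "(T ^^ (k * L)) (T y)" q p] by simp
  qed
  then show ?thesis using \<open>L \<ge> 1\<close> by blast
qed

section \<open>Observables distinguishing a non-dense orbit\<close>

lemma continuous_on_funpow:
  fixes T :: "'a::topological_space \<Rightarrow> 'a"
  assumes "continuous_on UNIV T"
  shows "continuous_on UNIV (T ^^ n)"
proof (induction n)
  case 0
  show ?case by (simp add: id_def)
next
  case (Suc n)
  show ?case
    unfolding funpow.simps
    by (rule continuous_on_compose [OF Suc]) (rule continuous_on_subset [OF assms], simp)
qed

lemma sum_ge_count_of_multiples:
  fixes g :: "nat \<Rightarrow> real"
  assumes "L \<ge> 1" and nonneg: "\<And>i. 0 \<le> g i" and one: "\<And>k. g (k * L) = 1"
  shows "real k \<le> (\<Sum>i<k * L. g i)"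
proof (induction k)
  case 0
  show ?case by simp
next
  case (Suc k)
  have "1 = g (k * L)" using one by simp
  also have "\<dots> \<le> (\<Sum>i\<in>{k * L..<Suc k * L}. g i)"
    using \<open>L \<ge> 1\<close> nonneg by (intro member_le_sum) auto
  finally have "1 \<le> (\<Sum>i\<in>{k * L..<Suc k * L}. g i)" .
  moreover have "(\<Sum>i<Suc k * L. g i) = (\<Sum>i<k * L. g i) + (\<Sum>i\<in>{k * L..<Suc k * L}. g i)"
    using sum.atLeastLessThan_concat [of 0 "k * L" "Suc k * L" g]
    by (simp add: atLeast0LessThan)
  ultimately show ?case using Suc by simp
qed

lemma sum_lessThan_add:
  fixes g :: "nat \<Rightarrow> real"
  shows "(\<Sum>i<m + k. g i) = (\<Sum>i<m. g i) + (\<Sum>i<k. g (m + i))"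
  by (induction k) simp_all

text \<open>
  A continuous \<open>\<phi>\<close> that is \<open>0\<close> near the orbit of \<open>x\<close> and \<open>1\<close> near a point \<open>q\<close> off its closure has
  small averages along orbits that eventually follow \<open>x\<close>, and averages with upper limit at least
  \<open>1 / L\<close> along orbits that eventually follow a point returning to \<open>q\<close> every \<open>L\<close> steps.  As both kinds of
  orbit start densely, \<open>dense_oscillation_imp_not_convergent\<close> applies.
\<close>

lemma irregular_observable_vanishing_on_orbit:
  fixes T :: "'a::metric_space \<Rightarrow> 'a"
  assumes compact: "compact (UNIV :: 'a set)"
    and cont: "continuous_on UNIV T"
    and trans: "topologically_transitive T"
    and shadow: "shadowing_property T"
    and "x \<notin> Trans T"
  shows "\<exists>\<phi>\<in>irregular_observables T. \<forall>n. \<phi> ((T ^^ n) x) = 0"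
proof -
  define K where "K = range (\<lambda>n. (T ^^ n) x)"
  obtain q where "q \<notin> closure K" using \<open>x \<notin> Trans T\<close> by (auto simp: Trans_def K_def)
  define r where "r = infdist q K"
  have "0 < r"
    using \<open>q \<notin> closure K\<close> infdist_nonneg [of q K]
    by (simp add: r_def K_def in_closure_iff_infdist_zero order_less_le)
  \<comment> \<open>Vanishes within distance \<open>r / 3\<close> of \<open>K\<close>, equals \<open>1\<close> from distance \<open>2 * r / 3\<close> onwards.\<close>
  define \<phi> where "\<phi> y = min 1 (max 0 (3 * infdist y K / r - 1))" for y
  have \<phi>_cont: "continuous_on UNIV \<phi>"
    unfolding \<phi>_def using \<open>0 < r\<close> by (intro continuous_intros) auto
  have \<phi>_range: "0 \<le> \<phi> y" "\<phi> y \<le> 1" for y by (auto simp: \<phi>_def)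
  have \<phi>_zero: "\<phi> y = 0" if "dist y ((T ^^ j) x) < r / 3" for y j
  proof -
    have "infdist y K \<le> dist y ((T ^^ j) x)" by (rule infdist_le) (simp add: K_def)
    then have "infdist y K < r / 3" using that by simp
    then show ?thesis using \<open>0 < r\<close> by (simp add: \<phi>_def field_simps)
  qed
  have \<phi>_one: "\<phi> y = 1" if "dist y q < r / 3" for y
  proof -
    have "2 * r / 3 \<le> infdist y K"
      using infdist_triangle [of q K y] that by (simp add: r_def dist_commute)
    then show ?thesis using \<open>0 < r\<close> by (simp add: \<phi>_def field_simps)
  qed
  obtain w L where "L \<ge> 1" and w: "\<And>k. dist ((T ^^ (k * L)) w) q < r / 6"
    using regularly_returning_point [OF trans shadow, of "r / 6" q] \<open>0 < r\<close> by auto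
  define A where "A n z = (\<Sum>j<n. \<phi> ((T ^^ j) z)) / real n" for n z
  have "\<exists>z. \<not> convergent (\<lambda>n. A n z)"
  proof (rule dense_oscillation_imp_not_convergent [OF compact])
    show "continuous_on UNIV (A n)" for n
      unfolding A_def divide_inverse
      by (intro continuous_intros continuous_on_compose2 [OF \<phi>_cont] continuous_on_funpow [OF cont])
        simp
    show "1 / (4 * real L) < 1 / (2 * real L)" using \<open>L \<ge> 1\<close> by (simp add: field_simps)
  next
    fix U :: "'a set" and N :: nat
    assume "open U" "U \<noteq> {}"
    then obtain z m where "z \<in> U"
      and z: "\<And>j. dist ((T ^^ (m + j)) z) ((T ^^ j) x) < r / 3"
      using dense_tail_tracing [OF trans shadow, of U "r / 3" x] \<open>0 < r\<close> by auto
    \<comment> \<open>Only the first \<open>m\<close> terms of the sum can be nonzero, so more than \<open>4 * L * m\<close> terms suffice.\<close>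
    define k where "k = N + 4 * L * m + 1"
    have "(\<Sum>j<m + k. \<phi> ((T ^^ j) z)) = (\<Sum>j<m. \<phi> ((T ^^ j) z))"
      using \<phi>_zero [OF z] by (simp add: sum_lessThan_add)
    also have "\<dots> \<le> m"
      using sum_bounded_above [of "{..<m}" "\<lambda>j. \<phi> ((T ^^ j) z)" 1] \<phi>_range by simp
    finally have "A (m + k) z \<le> m / real (m + k)"
      unfolding A_def by (rule divide_right_mono) simp
    also have "m / real (m + k) < 1 / (4 * real L)"
    proof -
      have "4 * L * m < m + k" by (simp add: k_def)
      then have "4 * real L * real m < real (m + k)"
        by (metis of_nat_less_iff of_nat_mult of_nat_numeral)
      moreover have "0 < real (m + k)" unfolding of_nat_0_less_iff by (simp add: k_def)
      ultimately show ?thesis using \<open>L \<ge> 1\<close> by (simp add: field_simps)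
    qed
    finally show "\<exists>z\<in>U. \<exists>n\<ge>N. A n z < 1 / (4 * real L)"
      using \<open>z \<in> U\<close> by (intro bexI [of _ z] exI [of _ "m + k"]) (simp_all add: k_def)
  next
    fix U :: "'a set" and N :: nat
    assume "open U" "U \<noteq> {}"
    then obtain z m where "z \<in> U"
      and z: "\<And>j. dist ((T ^^ (m + j)) z) ((T ^^ j) w) < r / 6"
      using dense_tail_tracing [OF trans shadow, of U "r / 6" w] \<open>0 < r\<close> by auto
    have near: "dist ((T ^^ (m + k * L)) z) q < r / 3" for k
      using z [of "k * L"] w [of k]
        dist_triangle [of "(T ^^ (m + k * L)) z" q "(T ^^ (k * L)) w"] by simp
    \<comment> \<open>At least \<open>k\<close> terms out of \<open>m + k * L\<close> equal \<open>1\<close>; the ratio exceeds \<open>1 / (2 * L)\<close> once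
      \<open>m < k * L\<close>.\<close>
    define k where "k = N + m + 1"
    define n where "n = m + k * L"
    have k: "m < k" "N \<le> k" by (simp_all add: k_def)
    have kL: "k \<le> k * L" using \<open>L \<ge> 1\<close> by simp
    have "real k \<le> (\<Sum>j<k * L. \<phi> ((T ^^ (m + j)) z))"
      by (rule sum_ge_count_of_multiples) (use \<open>L \<ge> 1\<close> \<phi>_range \<phi>_one [OF near] in auto)
    also have "\<dots> \<le> (\<Sum>j<n. \<phi> ((T ^^ j) z))"
      unfolding n_def sum_lessThan_add using \<phi>_range by (simp add: sum_nonneg)
    finally have "k / real n \<le> A n z"
      unfolding A_def by (rule divide_right_mono) simp
    moreover have "1 / (2 * real L) < k / real n"
    proof -
      have "n < 2 * (k * L)" "0 < n" using k kL unfolding n_def by linarith+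
      then have "real n < 2 * (real k * real L)"
        by (metis of_nat_less_iff of_nat_mult of_nat_numeral)
      with \<open>0 < n\<close> show ?thesis using \<open>L \<ge> 1\<close> by (simp add: divide_simps mult_ac)
    qed
    moreover have "N \<le> n" using k kL unfolding n_def by linarith
    ultimately show "\<exists>z\<in>U. \<exists>n\<ge>N. 1 / (2 * real L) < A n z"
      using \<open>z \<in> U\<close> by (meson less_le_trans)
  qed
  then have "\<phi> \<in> irregular_observables T"
    using \<phi>_cont by (auto simp: irregular_observables_def irregular_set_def A_def)
  moreover have "\<phi> ((T ^^ n) x) = 0" for n using \<phi>_zero [of _ n] \<open>0 < r\<close> by simp
  ultimately show ?thesis by blast
qed

theorem proposition6p1:
  fixes T :: "'a::{metric_space, perfect_space} \<Rightarrow> 'a"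
  assumes "compact (UNIV :: 'a set)"
    and "continuous_on UNIV T"
    and "topologically_transitive T"
    and "shadowing_property T"
    and "\<not> uniquely_ergodic T"
  shows "completely_irregular T \<subseteq> Trans T"
proof
  fix x assume x: "x \<in> completely_irregular T"
  show "x \<in> Trans T"
  proof (rule ccontr)
    assume "x \<notin> Trans T"
    then obtain \<phi> where "\<phi> \<in> irregular_observables T" and zero: "\<And>n. \<phi> ((T ^^ n) x) = 0"
      using irregular_observable_vanishing_on_orbit assms(1-4) by blast
    then have "x \<in> irregular_set T \<phi>" using x by (auto simp: completely_irregular_def)
    then show False by (simp add: irregular_set_def zero convergent_const)
  qed
qed

end
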